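(* Let $F_k(w)=\tfrac12 w^\top H_k w+l_k^\top w$ for $k=1,\dots,K$, with $H_k\in\mathbb{R}^{d\times d}$ symmetric and $l_k\in\mathbb{R}^d$, let $f=\frac1K\sum_{k=1}^K F_k$ and $H=\frac1K\sum_{k=1}^K H_k$. Let $0<\lambda\le L$ be such that $\lambda I\preceq H\preceq LI$, let $\hat w=\arg\min_w f(w)$, and assume that $\{F_k\}$ are $\delta$-related with $\delta\ge0$. Choose $\mu=\max\{0,(8\delta^2/\lambda)-\lambda\}$, $\eta=1$, and let $$\gamma=\begin{cases}1/8&\text{if }2\sqrt2\,\delta\le\lambda,\\ \lambda^2/(192\delta^2)&\text{otherwise,}\end{cases}\qquad \tilde\rho:=\begin{cases}2/3&\text{if }2\sqrt2\,\delta\le\lambda,\\ 1-\lambda^2/(24\delta^2)&\text{otherwise.}\end{cases}$$ Then the iterates $\{w^t\}$ of INEXACTDANE with Option I applied to $f=\frac1K\sum_kF_k$ with these parameters, from any initial point $w^0\in\mathbb{R}^d$, satisfy for all $t\ge1$ $$\|w^t-\hat w\|\le\tilde\rho\,\|w^{t-1}-\hat w\|.$$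
   Context: $\|\cdot\|$ is the Euclidean norm for vectors and the spectral norm for matrices. The quadratic functions $\{F_k\}$ are called $\delta$-related if $\|H_k-H_{k'}\|\le\delta$ and $\|l_k-l_{k'}\|\le\delta$ for all $k,k'\in\{1,\dots,K\}$. INEXACTDANE (Option I) for $f=\frac1K\sum_{k=1}^K F_k$ with parameters $\mu\ge0$, $\eta>0$, $0\le\gamma<1$: starting from $w^0$, for $t=1,2,\dots$ and each $k\in\{1,\dots,K\}$ set $$g^t_{k,\mu}(w)=F_k(w)-\langle\nabla F_k(w^{t-1})-\eta\nabla f(w^{t-1}),w\rangle+\tfrac{\mu}{2}\|w-w^{t-1}\|^2,\qquad \hat w_k^t=\arg\min_w g^t_{k,\mu}(w),$$ let $w_k^t$ be any point with $\|w_k^t-\hat w_k^t\|\le\gamma\|w^{t-1}-\hat w_k^t\|$, and put $w^t=\frac1K\sum_{k=1}^K w_k^t$. *)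

theory Defs
  imports "HOL-Analysis.Analysis"
begin

text \<open>The norm instance of \<^typ>\<open>real ^ 'n ^ 'm\<close> is the Frobenius norm; the spectral norm is
  the operator norm induced by the Euclidean norm.\<close>

definition spectral_norm :: "real ^ 'n ^ 'm \<Rightarrow> real"
  where "spectral_norm A = onorm (\<lambda>x. A *v x)"

definition symmetric_matrix :: "real ^ 'n ^ 'n \<Rightarrow> bool"
  where "symmetric_matrix A \<longleftrightarrow> transpose A = A"

definition positive_semidefinite :: "real ^ 'n ^ 'n \<Rightarrow> bool"
  where "positive_semidefinite A \<longleftrightarrow> symmetric_matrix A \<and> (\<forall>x. 0 \<le> x \<bullet> (A *v x))"

definition loewner_le :: "real ^ 'n ^ 'n \<Rightarrow> real ^ 'n ^ 'n \<Rightarrow> bool"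
  where "loewner_le A B \<longleftrightarrow> positive_semidefinite (B - A)"

definition average :: "nat \<Rightarrow> (nat \<Rightarrow> 'a::real_vector) \<Rightarrow> 'a"
  where "average K X = (1 / real K) *\<^sub>R (\<Sum>k=1..K. X k)"

definition quadratic :: "real ^ 'n ^ 'n \<Rightarrow> real ^ 'n \<Rightarrow> real ^ 'n \<Rightarrow> real"
  where "quadratic A b w = 1/2 * (w \<bullet> (A *v w)) + b \<bullet> w"

definition delta_related ::
    "nat \<Rightarrow> (nat \<Rightarrow> real ^ 'n ^ 'n) \<Rightarrow> (nat \<Rightarrow> real ^ 'n) \<Rightarrow> real \<Rightarrow> bool"
  where "delta_related K H l \<delta> \<longleftrightarrow>
    (\<forall>k\<in>{1..K}. \<forall>k'\<in>{1..K}. spectral_norm (H k - H k') \<le> \<delta> \<and> norm (l k - l k') \<le> \<delta>)"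

definition gradient :: "('a::real_inner \<Rightarrow> real) \<Rightarrow> 'a \<Rightarrow> 'a"
  where "gradient f x = (THE D. GDERIV f x :> D)"

text \<open>The subproblem objective at the point \<open>v\<close>, where \<open>f\<close> is the global objective and
  \<open>Fk\<close> one of its components.\<close>

definition dane_objective ::
    "('a::real_inner \<Rightarrow> real) \<Rightarrow> ('a \<Rightarrow> real) \<Rightarrow> real \<Rightarrow> real \<Rightarrow> 'a \<Rightarrow> 'a \<Rightarrow> real"
  where "dane_objective f Fk \<mu> \<eta> v w =
    Fk w - (gradient Fk v - \<eta> *\<^sub>R gradient f v) \<bullet> w + \<mu> / 2 * (norm (w - v))\<^sup>2"

definition dane_minimizer ::
    "('a::real_inner \<Rightarrow> real) \<Rightarrow> ('a \<Rightarrow> real) \<Rightarrow> real \<Rightarrow> real \<Rightarrow> 'a \<Rightarrow> 'a"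
  where "dane_minimizer f Fk \<mu> \<eta> v = (ARG_MIN (dane_objective f Fk \<mu> \<eta> v) w. True)"

text \<open>The inexact local solutions are arbitrary within the prescribed accuracy, so the method is
  a relation on sequences rather than a function of the initial point; \<open>u k\<close> is the local
  solution of component \<open>k\<close> in the current round.\<close>

definition inexact_dane_iterates ::
    "nat \<Rightarrow> (nat \<Rightarrow> 'a::real_inner \<Rightarrow> real) \<Rightarrow> real \<Rightarrow> real \<Rightarrow> real \<Rightarrow> 'a \<Rightarrow> (nat \<Rightarrow> 'a) \<Rightarrow> bool"
  where "inexact_dane_iterates K F \<mu> \<eta> \<gamma> w0 w \<longleftrightarrow>
    w 0 = w0 \<and>
    (\<forall>t\<ge>1. \<exists>u.
      (\<forall>k\<in>{1..K}.
        let m = dane_minimizer (\<lambda>x. average K (\<lambda>j. F j x)) (F k) \<mu> \<eta> (w (t - 1))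
        in norm (u k - m) \<le> \<gamma> * norm (w (t - 1) - m)) \<and>
      w t = average K u)"

end

theory Submission imports Defs begin

text \<open>Write \<open>A\<close> for the average of the Hessians, \<open>s = \<lambda> + \<mu>\<close>, \<open>G = A + \<mu>I\<close>,
  \<open>e = v - w'\<close> for the error at \<open>v\<close> relative to the optimum
  \<open>w'\<close>, and let \<open>z = G\<^sup>-\<^sup>1 e\<close>, \<open>x = A z\<close>, so that \<open>e = x + \<mu>z\<close>. The local
  step \<open>p\<^sub>k\<close> solves \<open>(H\<^sub>k + \<mu>I) p\<^sub>k = -A e = -G x\<close>, hence
  \<open>r\<^sub>k = p\<^sub>k + x\<close> solves \<open>(H\<^sub>k + \<mu>I) r\<^sub>k = (H\<^sub>k - A) x\<close> and is at most \<open>\<delta>/(s - \<delta>)\<close> times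
  \<open>\<bar>e\<bar>\<close>. The right-hand sides average to \<open>0\<close>, so \<open>G\<close> maps the average of the \<open>r\<^sub>k\<close> to the
  average of \<open>-(H\<^sub>k - A) r\<^sub>k\<close>: averaging cancels the first-order error and leaves
  \<open>\<delta>\<^sup>2/(s(s - \<delta>))\<close>. The exact new error is \<open>\<mu>z\<close> plus this average, where
  \<open>\<bar>\<mu>z\<bar> \<le> (\<mu>/s) \<bar>e\<bar>\<close>.\<close>

section \<open>Averages over the components\<close>

lemma average_cong: "(\<And>k. k \<in> {1..K} \<Longrightarrow> X k = Y k) \<Longrightarrow> average K X = average K Y"
  unfolding average_def by (metis (no_types, lifting) sum.cong)

lemma average_add: "average K (\<lambda>k. X k + Y k) = average K X + average K Y"
  by (simp add: average_def sum.distrib scaleR_right_distrib)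

lemma average_diff: "average K (\<lambda>k. X k - Y k) = average K X - average K Y"
  by (simp add: average_def sum_subtractf scaleR_right_diff_distrib)

lemma average_const: "K \<ge> 1 \<Longrightarrow> average K (\<lambda>k. c) = c"
  by (simp add: average_def sum_constant_scaleR)

lemma average_linear: "linear h \<Longrightarrow> average K (\<lambda>k. h (X k)) = h (average K X)"
  by (simp add: average_def linear_sum linear_scale)

lemma norm_average_le:
  assumes "K \<ge> 1" "\<And>k. k \<in> {1..K} \<Longrightarrow> norm (X k) \<le> c"
  shows "norm (average K X) \<le> c"
proof -
  have "norm (\<Sum>k=1..K. X k) \<le> real K * c"
    using sum_norm_bound[of "{1..K}" X c] assms(2) by simp
  then show ?thesis
    using assms(1) by (simp add: average_def field_simps)
qed

section \<open>Matrix-vector products and symmetric matrices\<close>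

lemma linear_matrix_vector_mult_left: "linear (\<lambda>A :: real ^ 'n ^ 'm. A *v x)"
  by (rule linearI) (simp_all add: matrix_vector_mult_add_rdistrib scaleR_matrix_vector_assoc)

lemma average_matrix_vector_mult:
  fixes H :: "nat \<Rightarrow> real ^ 'n ^ 'm"
  shows "average K H *v x = average K (\<lambda>k. H k *v x)"
  by (rule average_linear[OF linear_matrix_vector_mult_left, symmetric])

lemma norm_mult_le_spectral_norm: "norm (A *v x) \<le> spectral_norm A * norm x"
  unfolding spectral_norm_def by (rule onorm) simp

lemma inner_mult_symmetric: "symmetric_matrix A \<Longrightarrow> x \<bullet> (A *v y) = (A *v x) \<bullet> y"
  by (metis dot_lmul_matrix symmetric_matrix_def transpose_matrix_vector)

lemma shift_mult: "(A + \<mu> *\<^sub>R mat 1) *v x = A *v x + \<mu> *\<^sub>R x" for A :: "real ^ 'n ^ 'n"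
  by (simp add: matrix_vector_mult_add_rdistrib flip: scaleR_matrix_vector_assoc)

lemma symmetric_shift: "symmetric_matrix A \<Longrightarrow> symmetric_matrix (A + \<mu> *\<^sub>R mat 1)"
  by (simp add: symmetric_matrix_def transpose_def mat_def vec_eq_iff)

lemma symmetric_average:
  assumes "\<And>k. k \<in> {1..K} \<Longrightarrow> symmetric_matrix (H k)"
  shows "symmetric_matrix (average K H)"
proof -
  have "H k $ i $ j = H k $ j $ i" if "k \<in> {1..K}" for k i j
    using assms[OF that] unfolding symmetric_matrix_def transpose_def
    by (metis vec_lambda_beta)
  then show ?thesis
    by (simp add: symmetric_matrix_def transpose_def average_def vec_eq_iff)
qed

section \<open>Coercive matrices, minimizers and gradients of quadratics\<close>

lemma coercive_norm_le:
  fixes A :: "real ^ 'n ^ 'n"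
  assumes "\<And>y. s * (norm y)\<^sup>2 \<le> y \<bullet> (A *v y)"
  shows "s * norm x \<le> norm (A *v x)"
proof (cases "x = 0")
  case False
  have "s * norm x * norm x \<le> norm (A *v x) * norm x"
    using assms[of x] norm_cauchy_schwarz[of x "A *v x"] by (simp add: power2_eq_square mult_ac)
  then show ?thesis using False by simp
qed simp

text \<open>Coercivity makes the kernel trivial, and in finite dimension injective means surjective.
  Solvability obtained this way stands in for inverse matrices throughout.\<close>

lemma coercive_surj:
  fixes A :: "real ^ 'n ^ 'n"
  assumes "0 < s" "\<And>y. s * (norm y)\<^sup>2 \<le> y \<bullet> (A *v y)"
  obtains x where "A *v x = b"
proof -
  have "x = 0" if "A *v x = 0" for x
    using coercive_norm_le[OF assms(2), where x = x] that assms(1)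
    by (simp add: mult_le_0_iff)
  then have "inj ((*v) A)"
    using linear_injective_0[OF matrix_vector_mul_linear] by blast
  then have "surj ((*v) A)"
    using linear_injective_imp_surjective matrix_vector_mul_linear by blast
  then show ?thesis using that by (metis surjD)
qed

text \<open>The exact Taylor expansion about \<open>m\<close>; its linear term vanishes when
  \<open>m\<close> is stationary.\<close>

lemma quadratic_expand:
  assumes "symmetric_matrix A"
  shows "quadratic A b y =
    quadratic A b m + (A *v m + b) \<bullet> (y - m) + 1/2 * ((y - m) \<bullet> (A *v (y - m)))"
  using inner_mult_symmetric[OF assms, of m y]
  by (simp add: quadratic_def matrix_vector_mult_diff_distrib inner_diff inner_add
      inner_commute algebra_simps)

text \<open>About the stationary point \<open>m\<close>, \<open>g\<close> grows at least like
  \<open>s/2\<close> times the squared distance. So \<open>m\<close> is the only minimizer, and the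
  choice made by \<open>ARG_MIN\<close> has to be \<open>m\<close>. The constant \<open>c\<close>
  admits objectives that are quadratic up to an additive term.\<close>

lemma arg_min_quadratic:
  assumes "symmetric_matrix A" "0 < s" "\<And>y. s * (norm y)\<^sup>2 \<le> y \<bullet> (A *v y)"
    and g: "\<And>y. g y = quadratic A b y + c"
  shows "A *v (ARG_MIN g y. True) = - b"
proof -
  obtain m where m: "A *v m = - b"
    using coercive_surj[OF assms(2,3)] by blast
  have growth: "g m + s/2 * (norm (y - m))\<^sup>2 \<le> g y" for y
    using quadratic_expand[OF assms(1), of b y m] assms(3)[of "y - m"] m by (simp add: g)
  have "g m \<le> g y" for y
    using growth[of y] assms(2) by (smt (verit) divide_nonneg_nonneg mult_nonneg_nonneg zero_le_power2)
  then have "g (ARG_MIN g y. True) = g m"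
    by (intro arg_min_equality) auto
  then have "(norm ((ARG_MIN g y. True) - m))\<^sup>2 \<le> 0"
    using growth[of "ARG_MIN g y. True"] assms(2) by (simp add: mult_le_0_iff)
  then have "(ARG_MIN g y. True) = m" by simp
  then show ?thesis using m by simp
qed

text \<open>\<open>gradient\<close> is a definite description, so exhibiting a derivative must be
  complemented by uniqueness: a vector is determined by its inner products.\<close>

lemma gradient_quadratic:
  assumes "symmetric_matrix A"
  shows "gradient (quadratic A b) x = A *v x + b"
proof -
  have "((*v) A has_derivative (*v) A) (at x)"
    by (rule bounded_linear_imp_has_derivative) simp
  from has_derivative_add[OF
      has_derivative_mult_right[OF has_derivative_inner[OF has_derivative_ident this], of "1/2"]
      has_derivative_inner_right[OF has_derivative_ident, of b]]
  have "(quadratic A b has_derivative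
      (\<lambda>h. 1/2 * (x \<bullet> (A *v h) + h \<bullet> (A *v x)) + b \<bullet> h)) (at x)"
    unfolding quadratic_def .
  then have "GDERIV (quadratic A b) x :> A *v x + b"
    unfolding gderiv_def using inner_mult_symmetric[OF assms, of x]
    by (simp add: inner_add_right inner_commute)
  moreover have "E = D" if "GDERIV g x :> D" "GDERIV g x :> E" for g and D E :: "real ^ 'a"
    using has_derivative_unique[OF that[unfolded gderiv_def]] vector_eq_ldot by metis
  ultimately show ?thesis
    unfolding gradient_def by blast
qed

section \<open>The averaged objective and deviations from the mean Hessian\<close>

lemma average_quadratic:
  "average K (\<lambda>k. quadratic (H k) (l k) x) = quadratic (average K H) (average K l) x"
proof -
  have "average K (\<lambda>k. 1/2 * (x \<bullet> (H k *v x)) + l k \<bullet> x)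
      = 1/2 * (x \<bullet> average K (\<lambda>k. H k *v x)) + average K l \<bullet> x"
    by (simp add: average_def sum.distrib inner_sum_left inner_sum_right sum_distrib_left
        algebra_simps)
  then show ?thesis by (simp add: quadratic_def average_matrix_vector_mult)
qed

text \<open>The deviation from the mean is the mean of the pairwise deviations, so the pairwise
  bound carries over.\<close>

lemma delta_related_deviation:
  assumes "K \<ge> 1" "delta_related K H l \<delta>" "k \<in> {1..K}"
  shows "norm ((H k - average K H) *v x) \<le> \<delta> * norm x"
proof -
  have "(H k - average K H) *v x = average K (\<lambda>j. (H k - H j) *v x)"
    using assms(1)
    by (simp add: matrix_vector_mult_diff_rdistrib average_diff average_const
        average_matrix_vector_mult)
  moreover have "norm ((H k - H j) *v x) \<le> \<delta> * norm x" if "j \<in> {1..K}" for j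
  proof -
    have "spectral_norm (H k - H j) \<le> \<delta>"
      using assms that unfolding delta_related_def by blast
    then show ?thesis
      by (meson norm_mult_le_spectral_norm mult_right_mono norm_ge_zero order_trans)
  qed
  ultimately show ?thesis using norm_average_le[OF assms(1)] by metis
qed

text \<open>By Cauchy-Schwarz, passing from \<open>A\<close> to \<open>B\<close> costs at most
  \<delta> in the coercivity constant, while the shift adds \<mu>. It serves both the local systems
  and, with \<open>B = A\<close>, the averaged one.\<close>

lemma coercive_perturb:
  fixes A B :: "real ^ 'n ^ 'n"
  assumes "\<And>y. lam * (norm y)\<^sup>2 \<le> y \<bullet> (A *v y)"
    and "\<And>y. norm ((B - A) *v y) \<le> \<delta> * norm y"
  shows "(lam + \<mu> - \<delta>) * (norm x)\<^sup>2 \<le> x \<bullet> ((B + \<mu> *\<^sub>R mat 1) *v x)"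
proof -
  have "\<bar>x \<bullet> ((B - A) *v x)\<bar> \<le> norm x * (\<delta> * norm x)"
    by (meson Cauchy_Schwarz_ineq2 assms(2) mult_left_mono norm_ge_zero order_trans)
  then show ?thesis
    using assms(1)[of x] unfolding shift_mult
    by (simp add: matrix_vector_mult_diff_rdistrib inner_diff_right inner_add_right
        power2_norm_eq_inner[symmetric] power2_eq_square algebra_simps)
qed

section \<open>The local subproblem and one inexact round\<close>

text \<open>The correction term replaces the local gradient at \<open>v\<close> by the global one,
  so the local step is a Newton-like step for the global gradient with the shifted local
  Hessian.\<close>

lemma dane_minimizer_step:
  assumes "symmetric_matrix A" "symmetric_matrix B" "0 < s"
    and "\<And>y. s * (norm y)\<^sup>2 \<le> y \<bullet> ((B + \<mu> *\<^sub>R mat 1) *v y)"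
  shows "(B + \<mu> *\<^sub>R mat 1) *v (dane_minimizer (quadratic A a) (quadratic B b) \<mu> 1 v - v)
    = - (A *v v + a)"
proof -
  define g where "g = dane_objective (quadratic A a) (quadratic B b) \<mu> 1 v"
  \<comment> \<open>\<open>- c\<close> collects the terms linear in \<open>y\<close>; the local
    \<open>b\<close> cancels against the gradient correction.\<close>
  define c where "c = B *v v - A *v v - a + \<mu> *\<^sub>R v"
  have "g y = quadratic (B + \<mu> *\<^sub>R mat 1) (- c) y + \<mu> / 2 * (norm v)\<^sup>2" for y
    unfolding g_def c_def dane_objective_def gradient_quadratic[OF assms(1)]
      gradient_quadratic[OF assms(2)] quadratic_def shift_mult power2_norm_eq_inner
    by (simp add: inner_diff inner_add inner_commute algebra_simps)
  then have "(B + \<mu> *\<^sub>R mat 1) *v (ARG_MIN g y. True) = - (- c)"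
    by (intro arg_min_quadratic[OF symmetric_shift[OF assms(2)] assms(3,4)])
  then show ?thesis
    unfolding dane_minimizer_def g_def[symmetric] matrix_vector_mult_diff_distrib
    by (simp add: c_def shift_mult)
qed

text \<open>The three summands of the factor come from the proximal shift, from the differing
  Hessians after averaging, and from the inexact local solves.\<close>

lemma inexact_dane_round:
  fixes K :: nat and H :: "nat \<Rightarrow> real ^ 'd ^ 'd" and v wh :: "real ^ 'd"
  defines "A \<equiv> average K H"
  assumes K: "K \<ge> 1" and "0 < lam" "0 \<le> \<mu>" "0 \<le> \<delta>" "\<delta> < lam + \<mu>" "0 \<le> \<gamma>"
    and coer: "\<And>y. lam * (norm y)\<^sup>2 \<le> y \<bullet> (A *v y)"
    and dev: "\<And>k y. k \<in> {1..K} \<Longrightarrow> norm ((H k - A) *v y) \<le> \<delta> * norm y"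
    and step: "\<And>k. k \<in> {1..K} \<Longrightarrow> (H k + \<mu> *\<^sub>R mat 1) *v (m k - v) = - (A *v (v - wh))"
    and inexact: "\<And>k. k \<in> {1..K} \<Longrightarrow> norm (u k - m k) \<le> \<gamma> * norm (v - m k)"
  shows "norm (average K u - wh) \<le>
    (\<mu> / (lam + \<mu>) + \<delta>\<^sup>2 / ((lam + \<mu>) * (lam + \<mu> - \<delta>)) + \<gamma> * ((lam + \<mu>) / (lam + \<mu> - \<delta>)))
      * norm (v - wh)"
proof -
  define s where "s = lam + \<mu>"
  define e where "e = v - wh"
  define G where "G = A + \<mu> *\<^sub>R mat 1"
  have s: "0 < s" "\<delta> < s" "0 < s - \<delta>" using assms by (auto simp: s_def)
  have coerG: "s * (norm y)\<^sup>2 \<le> y \<bullet> (G *v y)" for y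
    using coercive_perturb[OF coer, of A 0 \<mu> y] by (simp add: G_def s_def)
  have coerB: "(s - \<delta>) * (norm y)\<^sup>2 \<le> y \<bullet> ((H k + \<mu> *\<^sub>R mat 1) *v y)"
    if "k \<in> {1..K}" for k y
    using coercive_perturb[OF coer dev[OF that]] by (simp add: s_def)
  obtain z where z: "G *v z = e" using coercive_surj[OF s(1) coerG] .
  define x where "x = A *v z"
  have e_eq: "e = x + \<mu> *\<^sub>R z" using z by (simp add: G_def x_def shift_mult)
  have Ae: "A *v e = A *v x + \<mu> *\<^sub>R x"
    by (simp add: e_eq x_def matrix_vector_right_distrib matrix_vector_mult_scaleR)
  have norm_z: "norm z \<le> norm e / s"
    using coercive_norm_le[OF coerG, of z] s z by (simp add: field_simps)
  \<comment> \<open>Expanding the square of \<open>e = x + \<mu> z\<close> leaves a cross term that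
    is nonnegative because \<open>z \<bullet> (A *v z)\<close> is.\<close>
  have norm_x: "norm x \<le> norm e"
  proof (rule power2_le_imp_le)
    have "0 \<le> z \<bullet> x"
      using coer[of z] \<open>0 < lam\<close> unfolding x_def
      by (smt (verit) mult_nonneg_nonneg zero_le_power2)
    then have "0 \<le> 2 * \<mu> * (z \<bullet> x) + (\<mu> * norm z)\<^sup>2"
      using \<open>0 \<le> \<mu>\<close> by simp
    moreover have "(norm e)\<^sup>2 = (norm x)\<^sup>2 + 2 * \<mu> * (z \<bullet> x) + (\<mu> * norm z)\<^sup>2"
      unfolding e_eq power_mult_distrib power2_norm_eq_inner
      by (simp add: inner_add inner_commute power2_eq_square algebra_simps)
    ultimately show "(norm x)\<^sup>2 \<le> (norm e)\<^sup>2" by simp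
  qed simp
  define r where "r k = m k - v + x" for k
  have Br: "(H k + \<mu> *\<^sub>R mat 1) *v r k = (H k - A) *v x" if "k \<in> {1..K}" for k
    using step[OF that] Ae unfolding r_def e_def[symmetric] matrix_vector_right_distrib
    by (simp add: shift_mult matrix_vector_mult_diff_rdistrib)
  have norm_r: "norm (r k) \<le> \<delta> / (s - \<delta>) * norm e" if "k \<in> {1..K}" for k
  proof -
    have "(s - \<delta>) * norm (r k) \<le> norm ((H k - A) *v x)"
      using coercive_norm_le[OF coerB[OF that], of "r k"] Br[OF that] by simp
    also have "\<dots> \<le> \<delta> * norm e"
      using dev[OF that, of x] norm_x \<open>0 \<le> \<delta>\<close> by (meson mult_left_mono order_trans)
    finally show ?thesis using s by (simp add: field_simps)
  qed
  have "G *v average K r = average K (\<lambda>k. G *v r k)"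
    by (rule average_linear[symmetric]) simp
  \<comment> \<open>Uses the splitting of \<open>G\<close> into the shifted local Hessian minus
    \<open>H k - A\<close>.\<close>
  also have "\<dots> = average K (\<lambda>k. (H k - A) *v x - (H k - A) *v r k)"
  proof (rule average_cong)
    fix k assume "k \<in> {1..K}"
    then show "G *v r k = (H k - A) *v x - (H k - A) *v r k"
      unfolding Br[OF \<open>k \<in> {1..K}\<close>, symmetric]
      by (simp add: G_def shift_mult matrix_vector_mult_diff_rdistrib)
  qed
  also have "\<dots> = - average K (\<lambda>k. (H k - A) *v r k)"
    using K by (simp add: average_diff matrix_vector_mult_diff_rdistrib average_const
        average_matrix_vector_mult A_def)
  finally have "norm (G *v average K r) = norm (average K (\<lambda>k. (H k - A) *v r k))"
    by simp
  also have "\<dots> \<le> \<delta> * (\<delta> / (s - \<delta>) * norm e)"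
    using norm_r dev \<open>0 \<le> \<delta>\<close>
    by (intro norm_average_le[OF K]) (meson mult_left_mono order_trans)
  finally have "s * norm (average K r) \<le> \<delta> * (\<delta> / (s - \<delta>) * norm e)"
    using coercive_norm_le[OF coerG, of "average K r"] by linarith
  then have norm_avg_r: "norm (average K r) \<le> \<delta>\<^sup>2 / (s * (s - \<delta>)) * norm e"
    using s by (simp add: field_simps power2_eq_square)
  \<comment> \<open>\<open>v\<close> is within
    \<open>1 + \<delta>/(s - \<delta>) = s/(s - \<delta>)\<close> times the norm of \<open>e\<close>
    from the exact local solution.\<close>
  have norm_u: "norm (u k - m k) \<le> \<gamma> * (s / (s - \<delta>)) * norm e" if "k \<in> {1..K}" for k
  proof -
    have "norm (v - m k) = norm (x - r k)" by (simp add: r_def)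
    also have "\<dots> \<le> norm e + \<delta> / (s - \<delta>) * norm e"
      using norm_triangle_ineq4[of x "r k"] norm_x norm_r[OF that] by linarith
    also have "\<dots> = s / (s - \<delta>) * norm e" using s by (simp add: field_simps)
    finally have "\<gamma> * norm (v - m k) \<le> \<gamma> * (s / (s - \<delta>) * norm e)"
      using \<open>0 \<le> \<gamma>\<close> by (rule mult_left_mono)
    then show ?thesis
      using inexact[OF that] by (simp only: mult.assoc)
  qed
  \<comment> \<open>Here \<open>m k = r k + (v - x)\<close>, and the constant part differs from the
    optimum by \<open>e - x = \<mu> z\<close>.\<close>
  have "average K u = average K (\<lambda>k. (u k - m k) + r k + (v - x))"
    by (simp add: r_def)
  also have "\<dots> = average K (\<lambda>k. u k - m k) + average K r + (v - x)"
    using K by (simp only: average_add average_const)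
  finally have "average K u - wh = average K (\<lambda>k. u k - m k) + average K r + \<mu> *\<^sub>R z"
    using e_eq by (simp add: e_def algebra_simps)
  also have "norm \<dots> \<le> norm (average K (\<lambda>k. u k - m k)) + norm (average K r) + norm (\<mu> *\<^sub>R z)"
    by (intro norm_triangle_mono order_refl)
  also have "\<dots> \<le> \<gamma> * (s / (s - \<delta>)) * norm e + \<delta>\<^sup>2 / (s * (s - \<delta>)) * norm e + \<mu> / s * norm e"
    using norm_average_le[OF K norm_u] norm_avg_r mult_left_mono[OF norm_z \<open>0 \<le> \<mu>\<close>] \<open>0 \<le> \<mu>\<close>
    by (intro add_mono) auto
  finally show ?thesis by (simp add: s_def e_def algebra_simps)
qed

section \<open>Contraction factors for the two regimes\<close>

lemma contraction_factor_small:
  fixes lam \<delta> :: real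
  assumes "0 < lam" "0 \<le> \<delta>" "2 * sqrt 2 * \<delta> \<le> lam"
  shows "8 * \<delta>\<^sup>2 \<le> lam\<^sup>2" "\<delta> < lam"
    "\<delta>\<^sup>2 / (lam * (lam - \<delta>)) + 1/8 * (lam / (lam - \<delta>)) \<le> 2/3"
proof -
  have "(2 * sqrt 2 * \<delta>)\<^sup>2 \<le> lam\<^sup>2"
    using assms by (intro power_mono) auto
  then show sq: "8 * \<delta>\<^sup>2 \<le> lam\<^sup>2" by (simp add: power_mult_distrib)
  \<comment> \<open>Weakening 8 to the perfect square 4 removes the root:
    \<open>2 * \<delta> \<le> lam\<close>, hence \<open>q\<close> is at least \<open>lam / 2\<close>
    and the factor ends up at most 1/2.\<close>
  have "(2 * \<delta>)\<^sup>2 \<le> lam\<^sup>2"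
    using sq by (simp add: power_mult_distrib) (use zero_le_power2[of \<delta>] in linarith)
  have half: "2 * \<delta> \<le> lam" using assms by (auto intro: power2_le_imp_le[OF \<open>(2 * \<delta>)\<^sup>2 \<le> lam\<^sup>2\<close>])
  then show "\<delta> < lam" using assms by linarith
  define q where "q = lam - \<delta>"
  have q: "0 < q" "lam \<le> 2 * q" using half \<open>\<delta> < lam\<close> by (simp_all add: q_def)
  have "\<delta>\<^sup>2 / (lam * q) + 1/8 * (lam / q) = (\<delta>\<^sup>2 + lam\<^sup>2 / 8) / (lam * q)"
    using q(1) \<open>0 < lam\<close> by (simp add: add_divide_distrib power2_eq_square)
  also have "\<dots> \<le> (lam\<^sup>2 / 4) / (lam * q)"
    using sq q(1) \<open>0 < lam\<close> by (intro divide_right_mono) auto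
  also have "\<dots> = lam / (4 * q)"
    using \<open>0 < lam\<close> by (simp add: power2_eq_square)
  also have "\<dots> \<le> 2/3"
    using q by (simp add: pos_divide_le_eq)
  finally show "\<delta>\<^sup>2 / (lam * (lam - \<delta>)) + 1/8 * (lam / (lam - \<delta>)) \<le> 2/3"
    by (simp add: q_def)
qed

text \<open>Here \<open>s\<close> is the value of \<open>lam + \<mu>\<close> for positive \<mu>. In
  units of \<open>lam\<^sup>2 / (24 * \<delta>\<^sup>2)\<close> the shift gains 3, while the other
  two terms together lose \<open>4 * \<delta> / q\<close>; a net gain of 1 suffices.\<close>

lemma contraction_factor_large:
  fixes lam \<delta> s :: real
  assumes "0 < lam" "0 \<le> \<delta>" "lam < 2 * sqrt 2 * \<delta>" and s: "s = 8 * \<delta>\<^sup>2 / lam"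
  shows "lam\<^sup>2 < 8 * \<delta>\<^sup>2" "\<delta> < s"
    "(s - lam) / s + \<delta>\<^sup>2 / (s * (s - \<delta>)) + lam\<^sup>2 / (192 * \<delta>\<^sup>2) * (s / (s - \<delta>))
      \<le> 1 - lam\<^sup>2 / (24 * \<delta>\<^sup>2)"
proof -
  have "lam\<^sup>2 < (2 * sqrt 2 * \<delta>)\<^sup>2"
    using assms by (intro power_strict_mono) auto
  then show sq: "lam\<^sup>2 < 8 * \<delta>\<^sup>2" by (simp add: power_mult_distrib)
  \<comment> \<open>Raising 8 to the perfect square 9 gives \<open>lam < 3 * \<delta>\<close>, so
    \<open>q > 5 * \<delta>\<close>, which makes \<open>4 * \<delta> / q\<close> less than
    2.\<close>
  then have "lam\<^sup>2 < (3 * \<delta>)\<^sup>2"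
    by (simp add: power_mult_distrib) (use zero_le_power2[of \<delta>] in linarith)
  have third: "lam < 3 * \<delta>" using assms by (auto intro: power2_less_imp_less[OF \<open>lam\<^sup>2 < (3 * \<delta>)\<^sup>2\<close>])
  have d: "0 < \<delta>" using third assms by linarith
  define q where "q = 8 * \<delta> - lam"
  have q: "0 < q" using third d by (simp add: q_def)
  have sd: "s - \<delta> = \<delta> * q / lam"
    using \<open>0 < lam\<close> by (simp add: s q_def divide_simps power2_eq_square right_diff_distrib)
  moreover have "0 < \<delta> * q / lam" using d q \<open>0 < lam\<close> by simp
  ultimately show "\<delta> < s" by linarith
  have "(s - lam) / s = 1 - lam\<^sup>2 / (8 * \<delta>\<^sup>2)"
    using d \<open>0 < lam\<close> by (simp add: s field_simps power2_eq_square)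
  moreover have "\<delta>\<^sup>2 / (s * (s - \<delta>)) = lam\<^sup>2 / (8 * \<delta> * q)"
    unfolding sd using d q \<open>0 < lam\<close> by (simp add: s power2_eq_square)
  moreover have "lam\<^sup>2 / (192 * \<delta>\<^sup>2) * (s / (s - \<delta>)) = lam\<^sup>2 / (24 * \<delta> * q)"
    unfolding sd using d q \<open>0 < lam\<close> by (simp add: s power2_eq_square)
  moreover have "1 - lam\<^sup>2 / (8 * \<delta>\<^sup>2) + lam\<^sup>2 / (8 * \<delta> * q) + lam\<^sup>2 / (24 * \<delta> * q)
      = 1 - lam\<^sup>2 / (24 * \<delta>\<^sup>2) * (3 - 4 * \<delta> / q)"
    using d q by (simp add: field_simps power2_eq_square)
  ultimately have "(s - lam) / s + \<delta>\<^sup>2 / (s * (s - \<delta>)) + lam\<^sup>2 / (192 * \<delta>\<^sup>2) * (s / (s - \<delta>))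
      = 1 - lam\<^sup>2 / (24 * \<delta>\<^sup>2) * (3 - 4 * \<delta> / q)"
    by simp
  also have "\<dots> \<le> 1 - lam\<^sup>2 / (24 * \<delta>\<^sup>2) * 1"
  proof -
    have "1 \<le> 3 - 4 * \<delta> / q" using third q d by (simp add: q_def field_simps)
    then have "lam\<^sup>2 / (24 * \<delta>\<^sup>2) * 1 \<le> lam\<^sup>2 / (24 * \<delta>\<^sup>2) * (3 - 4 * \<delta> / q)"
      by (intro mult_left_mono) auto
    then show ?thesis by linarith
  qed
  finally show "(s - lam) / s + \<delta>\<^sup>2 / (s * (s - \<delta>)) + lam\<^sup>2 / (192 * \<delta>\<^sup>2) * (s / (s - \<delta>))
      \<le> 1 - lam\<^sup>2 / (24 * \<delta>\<^sup>2)" by simp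
qed

section \<open>Contraction of the iterates\<close>

theorem theorem2:
  fixes K :: nat
    and H :: "nat \<Rightarrow> real ^ 'd ^ 'd"
    and l :: "nat \<Rightarrow> real ^ 'd"
    and F :: "nat \<Rightarrow> real ^ 'd \<Rightarrow> real"
    and f :: "real ^ 'd \<Rightarrow> real"
    and lam L \<delta> \<mu> \<eta> \<gamma> \<rho> :: real
    and w_hat w0 :: "real ^ 'd"
    and w :: "nat \<Rightarrow> real ^ 'd"
  assumes "K \<ge> 1"
    and "\<And>k. k \<in> {1..K} \<Longrightarrow> symmetric_matrix (H k)"
    and "\<And>k. k \<in> {1..K} \<Longrightarrow> F k = quadratic (H k) (l k)"
    and "f = (\<lambda>x. average K (\<lambda>k. F k x))"
    and "0 < lam" and "lam \<le> L"
    and "loewner_le (lam *\<^sub>R mat 1) (average K H)"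
    and "loewner_le (average K H) (L *\<^sub>R mat 1)"
    and "w_hat = (ARG_MIN f x. True)"
    and "0 \<le> \<delta>"
    and "delta_related K H l \<delta>"
    and "\<mu> = max 0 (8 * \<delta>\<^sup>2 / lam - lam)"
    and "\<eta> = 1"
    and "\<gamma> = (if 2 * sqrt 2 * \<delta> \<le> lam then 1/8 else lam\<^sup>2 / (192 * \<delta>\<^sup>2))"
    and "\<rho> = (if 2 * sqrt 2 * \<delta> \<le> lam then 2/3 else 1 - lam\<^sup>2 / (24 * \<delta>\<^sup>2))"
    and "inexact_dane_iterates K F \<mu> \<eta> \<gamma> w0 w"
  shows "\<forall>t\<ge>1. norm (w t - w_hat) \<le> \<rho> * norm (w (t - 1) - w_hat)"
proof (intro allI impI)
  fix t :: nat assume "t \<ge> 1"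
  define A where "A = average K H"
  define v where "v = w (t - 1)"
  have symA: "symmetric_matrix A"
    unfolding A_def by (intro symmetric_average assms(2))
  have coer: "lam * (norm y)\<^sup>2 \<le> y \<bullet> (A *v y)" for y
  proof -
    have "0 \<le> y \<bullet> ((A - lam *\<^sub>R mat 1) *v y)"
      using assms(7) by (simp add: loewner_le_def positive_semidefinite_def A_def)
    then show ?thesis
      by (simp add: matrix_vector_mult_diff_rdistrib inner_diff_right power2_norm_eq_inner
          flip: scaleR_matrix_vector_assoc)
  qed
  have f: "f = quadratic A (average K l)"
  proof
    fix x
    have "f x = average K (\<lambda>k. quadratic (H k) (l k) x)"
      unfolding assms(4) by (intro average_cong) (simp add: assms(3))
    then show "f x = quadratic A (average K l) x"
      by (simp add: average_quadratic A_def)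
  qed
  have w_hat: "A *v w_hat = - average K l"
    unfolding assms(9) by (rule arg_min_quadratic[OF symA assms(5) coer, where c = 0]) (simp add: f)
  have dev: "norm ((H k - A) *v y) \<le> \<delta> * norm y" if "k \<in> {1..K}" for k y
    using delta_related_deviation[OF assms(1,11) that] by (simp add: A_def)
  have params: "\<delta> < lam + \<mu> \<and> 0 \<le> \<mu> \<and> 0 \<le> \<gamma> \<and>
      \<mu> / (lam + \<mu>) + \<delta>\<^sup>2 / ((lam + \<mu>) * (lam + \<mu> - \<delta>)) + \<gamma> * ((lam + \<mu>) / (lam + \<mu> - \<delta>)) \<le> \<rho>"
  proof (cases "2 * sqrt 2 * \<delta> \<le> lam")
    case True
    note c = contraction_factor_small[OF assms(5,10) True]
    \<comment> \<open>\<open>8 * \<delta>\<^sup>2 \<le> lam\<^sup>2\<close> makes the second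
      argument of \<open>max\<close> nonpositive, so the shift term of the factor vanishes.\<close>
    have \<mu>: "\<mu> = 0" using c(1) assms(5,12) by (simp add: field_simps power2_eq_square)
    have "\<gamma> = 1/8" "\<rho> = 2/3" using True assms(14,15) by simp_all
    then show ?thesis
      unfolding \<mu> by (simp only:) (use c in simp)
  next
    case False
    then have large: "lam < 2 * sqrt 2 * \<delta>" by simp
    note c = contraction_factor_large[OF assms(5,10) large refl]
    have "lam < 8 * \<delta>\<^sup>2 / lam" using c(1) assms(5) by (simp add: field_simps power2_eq_square)
    then have \<mu>: "\<mu> = 8 * \<delta>\<^sup>2 / lam - lam" "0 \<le> \<mu>" using assms(12) by simp_all
    then have "lam + \<mu> = 8 * \<delta>\<^sup>2 / lam" by simp
    then show ?thesis using c(2,3) \<mu> False assms(14,15) by simp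
  qed
  define m where "m k = dane_minimizer f (F k) \<mu> \<eta> v" for k
  have step: "(H k + \<mu> *\<^sub>R mat 1) *v (m k - v) = - (A *v (v - w_hat))" if "k \<in> {1..K}" for k
  proof -
    have "(H k + \<mu> *\<^sub>R mat 1) *v (m k - v) = - (A *v v + average K l)"
      unfolding m_def f assms(3)[OF that] assms(13)
      using params coercive_perturb[OF coer dev[OF that]]
      by (intro dane_minimizer_step[OF symA assms(2)[OF that], of "lam + \<mu> - \<delta>"]) auto
    \<comment> \<open>Stationarity of \<open>w_hat\<close> turns the global gradient at
      \<open>v\<close> into \<open>A\<close> applied to the error.\<close>
    then show ?thesis by (simp add: matrix_vector_mult_diff_distrib w_hat)
  qed
  obtain u where u: "\<And>k. k \<in> {1..K} \<Longrightarrow> norm (u k - m k) \<le> \<gamma> * norm (v - m k)"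
    and wt: "w t = average K u"
    using assms(16) \<open>t \<ge> 1\<close>
    unfolding inexact_dane_iterates_def Let_def m_def v_def assms(4) by blast
  have "norm (w t - w_hat) \<le>
      (\<mu> / (lam + \<mu>) + \<delta>\<^sup>2 / ((lam + \<mu>) * (lam + \<mu> - \<delta>)) + \<gamma> * ((lam + \<mu>) / (lam + \<mu> - \<delta>)))
        * norm (v - w_hat)"
    unfolding wt
    by (rule inexact_dane_round[OF assms(1,5)])
      (use params assms(10) coer dev step u in \<open>auto simp: A_def\<close>)
  also have "\<dots> \<le> \<rho> * norm (v - w_hat)"
    using params by (intro mult_right_mono) auto
  finally show "norm (w t - w_hat) \<le> \<rho> * norm (w (t - 1) - w_hat)"
    by (simp add: v_def)
qed

end
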